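(* $\mathcal{Z}^\mu$ is closed under multiplication (hence a $\mathbb{Q}[\mu]$-algebra): for all admissible bi-indices $(\mathbf{k}_1;\mathbf{m}_1),(\mathbf{k}_2;\mathbf{m}_2)$ and all special triples $(\mathbf{k}_3;\mathbf{m}_3;\tilde{\mathbf{m}}_3)$, $(\mathbf{k}_4;\mathbf{m}_4;\tilde{\mathbf{m}}_4)$, the products $\zeta^\mu(\mathbf{k}_1;\mathbf{m}_1)\zeta^\mu(\mathbf{k}_2;\mathbf{m}_2)$, $\zeta^\mu(\mathbf{k}_1;\mathbf{m}_1)\mathcal{D}^\mu(\mathbf{k}_3;\mathbf{m}_3;\tilde{\mathbf{m}}_3)$ and $\mathcal{D}^\mu(\mathbf{k}_3;\mathbf{m}_3;\tilde{\mathbf{m}}_3)\mathcal{D}^\mu(\mathbf{k}_4;\mathbf{m}_4;\tilde{\mathbf{m}}_4)$ all lie in $\mathcal{Z}^\mu$.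
   Context: Fix $\mu\in\mathbb{C}$ with $\mathrm{Re}(\mu)>0$; $\mathbb{Q}[\mu]\subset\mathbb{C}$ is the ring generated by $\mu$. A bi-index $(\mathbf{k};\mathbf{m})=(k_1,\dots,k_r;m_1,\dots,m_r)\in\mathbb{N}^r\times\mathbb{Q}^r$ is admissible if all $m_i>0$ and $k_r>1$; then $\zeta^{\mu}(\mathbf{k};\mathbf{m})=\sum_{0\le n_1\le\cdots\le n_r}\frac{\mu^r}{(n_1\mu+m_1)^{k_1}\cdots(n_r\mu+m_r)^{k_r}}$. A special triple $(\mathbf{k};\mathbf{m};\tilde{\mathbf{m}})$ has $\mathbf{k}=(k_1,\dots,k_{r-1},1)\in\mathbb{N}^r$, $\mathbf{m}=(m_1,\dots,m_r)$, $\tilde{\mathbf{m}}=(m_1,\dots,m_{r-1},\tilde m_r)$, all entries in $\mathbb{Q}_{>0}$, $m_r\ne\tilde m_r$; $\mathcal{D}^{\mu}(\mathbf{k};\mathbf{m};\tilde{\mathbf{m}})=(\tilde m_r-m_r)\sum_{0\le n_1\le\cdots\le n_r}\frac{\mu^r}{\prod_{i=1}^{r-1}(n_i\mu+m_i)^{k_i}(n_r\mu+m_r)(n_r\mu+\tilde m_r)}$. $\mathcal{Z}^\mu$ is the $\mathbb{Q}[\mu]$-linear span in $\mathbb{C}$ of $1$, all $\zeta^\mu(\mathbf{k};\mathbf{m})$ with $(\mathbf{k};\mathbf{m})$ admissible, and all $\mathcal{D}^\mu(\mathbf{k};\mathbf{m};\tilde{\mathbf{m}})$ with $(\mathbf{k};\mathbf{m};\tilde{\mathbf{m}})$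 a special triple. *)

theory Defs
  imports "HOL-Analysis.Analysis" "HOL-Computational_Algebra.Polynomial"
begin

definition rat_adjoin :: "complex \<Rightarrow> complex set" where
  "rat_adjoin \<mu> = {poly (map_poly of_rat p) \<mu> | p :: rat poly. True}"

definition span_over :: "complex set \<Rightarrow> complex set \<Rightarrow> complex set" where
  "span_over R G = {\<Sum>g\<in>F. c g * g | F c. finite F \<and> F \<subseteq> G \<and> (\<forall>g\<in>F. c g \<in> R)}"

definition subalgebra_over :: "complex set \<Rightarrow> complex set \<Rightarrow> bool" where
  "subalgebra_over R A \<longleftrightarrow>
     1 \<in> A \<and> (\<forall>x\<in>A. \<forall>y\<in>A. x + y \<in> A) \<and> (\<forall>c\<in>R. \<forall>x\<in>A. c * x \<in> A) \<and>
     (\<forall>x\<in>A. \<forall>y\<in>A. x * y \<in> A)"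

text \<open>Indices are lists of length \<open>r \<ge> 1\<close>, so the entry with subscript \<open>i\<close> in the usual
  notation is at position \<open>i - 1\<close>. Entries of \<open>k\<close> are positive integers.\<close>

definition admissible :: "nat list \<Rightarrow> rat list \<Rightarrow> bool" where
  "admissible k m \<longleftrightarrow>
     k \<noteq> [] \<and> length m = length k \<and> (\<forall>a\<in>set k. a \<ge> 1) \<and> (\<forall>a\<in>set m. a > 0) \<and> last k > 1"

definition special_triple :: "nat list \<Rightarrow> rat list \<Rightarrow> rat list \<Rightarrow> bool" where
  "special_triple k m m' \<longleftrightarrow>
     k \<noteq> [] \<and> length m = length k \<and> length m' = length k \<and>
     (\<forall>a\<in>set k. a \<ge> 1) \<and> (\<forall>a\<in>set m. a > 0) \<and> (\<forall>a\<in>set m'. a > 0) \<and>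
     last k = 1 \<and> butlast m = butlast m' \<and> last m \<noteq> last m'"

definition weak_chains :: "nat \<Rightarrow> nat list set" where
  "weak_chains r = {n. length n = r \<and> sorted n}"

text \<open>For \<open>Re \<mu> > 0\<close> the two series below converge absolutely on admissible bi-indices and
  special triples respectively, so unordered summation gives their usual values.\<close>

definition zeta_mu :: "complex \<Rightarrow> nat list \<Rightarrow> rat list \<Rightarrow> complex" where
  "zeta_mu \<mu> k m =
     (\<Sum>\<^sub>\<infinity>n\<in>weak_chains (length k).
        \<mu> ^ length k / (\<Prod>i<length k. (of_nat (n ! i) * \<mu> + of_rat (m ! i)) ^ (k ! i)))"

definition D_mu :: "complex \<Rightarrow> nat list \<Rightarrow> rat list \<Rightarrow> rat list \<Rightarrow> complex" where
  "D_mu \<mu> k m m' =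
     of_rat (last m' - last m) *
     (\<Sum>\<^sub>\<infinity>n\<in>weak_chains (length k).
        \<mu> ^ length k /
          ((\<Prod>i<length k - 1. (of_nat (n ! i) * \<mu> + of_rat (m ! i)) ^ (k ! i)) *
           (of_nat (last n) * \<mu> + of_rat (last m)) * (of_nat (last n) * \<mu> + of_rat (last m'))))"

definition Z_mu :: "complex \<Rightarrow> complex set" where
  "Z_mu \<mu> = span_over (rat_adjoin \<mu>)
     ({1} \<union> {zeta_mu \<mu> k m | k m. admissible k m}
          \<union> {D_mu \<mu> k m m' | k m m'. special_triple k m m'})"

end

theory Submission imports Defs begin

text \<open>
  Truncate all series at \<open>n\<^sub>r \<le> N\<close>. Summation by parts writes the product of two truncated nested
  sums, with outermost summands \<open>f\<close> and \<open>g\<close>, as a combination of nested sums whose outermost summand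
  is \<open>f\<close>, \<open>g\<close> or \<open>f g\<close>. By partial fractions, the product of any two of the functions
  \<open>\<mu> / (n \<mu> + m)\<^sup>k\<close> with \<open>k \<ge> 1\<close> is a \<open>\<rat>[\<mu>]\<close>-combination of those with \<open>k \<ge> 2\<close> and of
  differences of two with \<open>k = 1\<close>, which are exactly the outermost summands of the generators
  \<open>\<zeta>\<^sup>\<mu>\<close> and \<open>\<D>\<^sup>\<mu>\<close>. So the truncated generators span an algebra of sequences, and
  their limits form \<open>\<Z>\<^sup>\<mu>\<close>. The series converge absolutely because nested sums of terms
  \<open>O(1/(n+1))\<close> grow at most like \<open>\<surd>(N+1)\<close>.
\<close>

section \<open>Spans\<close>

text \<open>Sequences model summands and truncated sums alike. The inductive form suits the proofs
  below, which argue by how a combination is built up.\<close>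

inductive_set fun_span :: "complex set \<Rightarrow> (nat \<Rightarrow> complex) set \<Rightarrow> (nat \<Rightarrow> complex) set"
  for R G where
  fun_span_base: "f \<in> G \<Longrightarrow> f \<in> fun_span R G"
| fun_span_add: "f \<in> fun_span R G \<Longrightarrow> g \<in> fun_span R G \<Longrightarrow> (\<lambda>n. f n + g n) \<in> fun_span R G"
| fun_span_scale: "c \<in> R \<Longrightarrow> f \<in> fun_span R G \<Longrightarrow> (\<lambda>n. c * f n) \<in> fun_span R G"

lemma fun_span_diff:
  assumes "-1 \<in> R" "f \<in> fun_span R G" "g \<in> fun_span R G"
  shows "(\<lambda>n. f n - g n) \<in> fun_span R G"
proof -
  have "(\<lambda>n. f n + (-1) * g n) \<in> fun_span R G"
    using assms by (intro fun_span_add fun_span_scale)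
  then show ?thesis by simp
qed

lemma fun_span_mono:
  assumes "f \<in> fun_span R G" "G \<subseteq> fun_span R H"
  shows "f \<in> fun_span R H"
  using assms(1)
proof induction
  case (fun_span_base f) then show ?case using assms(2) by blast
qed (auto intro: fun_span_add fun_span_scale)

text \<open>Induction on \<open>f\<close>, then on \<open>g\<close>. It serves two operations: the
  pointwise product, and the one sending \<open>f\<close> and \<open>b\<close> to the partial sums
  of \<open>f n * b n\<close>.\<close>

lemma fun_span_bilinear:
  assumes f: "f \<in> fun_span R G" and g: "g \<in> fun_span R H"
    and base: "\<And>f g. f \<in> G \<Longrightarrow> g \<in> H \<Longrightarrow> \<Phi> f g \<in> fun_span R K"
    and add1: "\<And>f f' g. \<Phi> (\<lambda>n. f n + f' n) g = (\<lambda>n. \<Phi> f g n + \<Phi> f' g n)"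
    and scale1: "\<And>c f g. \<Phi> (\<lambda>n. c * f n) g = (\<lambda>n. c * \<Phi> f g n)"
    and add2: "\<And>f g g'. \<Phi> f (\<lambda>n. g n + g' n) = (\<lambda>n. \<Phi> f g n + \<Phi> f g' n)"
    and scale2: "\<And>c f g. \<Phi> f (\<lambda>n. c * g n) = (\<lambda>n. c * \<Phi> f g n)"
  shows "\<Phi> f g \<in> fun_span R K"
  using f
proof induction
  case (fun_span_base f)
  show ?case using g
  proof induction
    case (fun_span_base g)
    with \<open>f \<in> G\<close> show ?case by (rule base)
  qed (auto simp: add2 scale2 intro: fun_span_add fun_span_scale)
qed (auto simp: add1 scale1 intro: fun_span_add fun_span_scale)

lemma span_over_base:
  assumes "1 \<in> R" "g \<in> G"
  shows "g \<in> span_over R G"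
  unfolding span_over_def using assms by (intro CollectI exI[of _ "{g}"] exI[of _ "\<lambda>_. 1"]) auto

lemma span_over_add:
  assumes R: "0 \<in> R" "\<And>a b. a \<in> R \<Longrightarrow> b \<in> R \<Longrightarrow> a + b \<in> R"
    and "x \<in> span_over R G" "y \<in> span_over R G"
  shows "x + y \<in> span_over R G"
proof -
  obtain F c where F: "finite F" "F \<subseteq> G" "\<forall>g\<in>F. c g \<in> R" "x = (\<Sum>g\<in>F. c g * g)"
    using assms(3) unfolding span_over_def by blast
  obtain F' c' where F': "finite F'" "F' \<subseteq> G" "\<forall>g\<in>F'. c' g \<in> R" "y = (\<Sum>g\<in>F'. c' g * g)"
    using assms(4) unfolding span_over_def by blast
  \<comment> \<open>Extending both coefficient families by 0 lets both sums range over
    \<open>F \<union> F'\<close>.\<close>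
  define d where "d g = (if g \<in> F then c g else 0) + (if g \<in> F' then c' g else 0)" for g
  have "x = (\<Sum>g\<in>F \<union> F'. (if g \<in> F then c g else 0) * g)"
    unfolding F(4) using F(1) F'(1) by (intro sum.mono_neutral_cong_left) auto
  moreover have "y = (\<Sum>g\<in>F \<union> F'. (if g \<in> F' then c' g else 0) * g)"
    unfolding F'(4) using F(1) F'(1) by (intro sum.mono_neutral_cong_left) auto
  ultimately have "x + y = (\<Sum>g\<in>F \<union> F'. d g * g)"
    by (simp add: d_def sum.distrib distrib_right)
  moreover have "\<forall>g\<in>F \<union> F'. d g \<in> R"
    using F(3) F'(3) R by (auto simp: d_def)
  moreover have "finite (F \<union> F')" "F \<union> F' \<subseteq> G" using F F' by auto
  ultimately show ?thesis unfolding span_over_def by blast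
qed

lemma span_over_scale:
  assumes R: "\<And>a b. a \<in> R \<Longrightarrow> b \<in> R \<Longrightarrow> a * b \<in> R"
    and "a \<in> R" "x \<in> span_over R G"
  shows "a * x \<in> span_over R G"
proof -
  obtain F c where F: "finite F" "F \<subseteq> G" "\<forall>g\<in>F. c g \<in> R" "x = (\<Sum>g\<in>F. c g * g)"
    using assms(3) unfolding span_over_def by blast
  have "a * x = (\<Sum>g\<in>F. (a * c g) * g)"
    by (simp add: F(4) sum_distrib_left mult.assoc)
  moreover have "\<forall>g\<in>F. a * c g \<in> R" using F(3) assms(2) R by blast
  ultimately show ?thesis using F(1,2) unfolding span_over_def
    by (intro CollectI exI[of _ F] exI[of _ "\<lambda>g. a * c g"]) simp
qed

lemma span_over_induct [consumes 1, case_names zero base]: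
  assumes "x \<in> span_over R G"
    and "P 0" "\<And>c g y. c \<in> R \<Longrightarrow> g \<in> G \<Longrightarrow> P y \<Longrightarrow> P (c * g + y)"
  shows "P x"
proof -
  obtain F c where F: "finite F" "F \<subseteq> G" "\<forall>g\<in>F. c g \<in> R" "x = (\<Sum>g\<in>F. c g * g)"
    using assms(1) unfolding span_over_def by blast
  have "P (\<Sum>g\<in>F. c g * g)" using F(1-3)
    by (induction F rule: finite_induct) (auto intro: assms)
  with F(4) show ?thesis by simp
qed

section \<open>The coefficient ring\<close>

lemma poly_map_of_rat_add:
  "poly (map_poly of_rat (p + q)) (x :: complex) =
     poly (map_poly of_rat p) x + poly (map_poly of_rat q) x"
proof -
  have "map_poly of_rat (p + q) = (map_poly of_rat p + map_poly of_rat q :: complex poly)"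
    by (intro poly_eqI) (simp add: coeff_map_poly of_rat_add)
  then show ?thesis by simp
qed

lemma poly_map_of_rat_smult:
  "poly (map_poly of_rat (smult a p)) (x :: complex) = of_rat a * poly (map_poly of_rat p) x"
proof -
  have "map_poly of_rat (smult a p) = (smult (of_rat a) (map_poly of_rat p) :: complex poly)"
    by (intro poly_eqI) (simp add: coeff_map_poly of_rat_mult)
  then show ?thesis by simp
qed

text \<open>Peeling off the constant coefficient of \<open>p\<close> reduces multiplicativity to the
  additive and scalar cases.\<close>

lemma poly_map_of_rat_mult:
  "poly (map_poly of_rat (p * q)) (x :: complex) =
     poly (map_poly of_rat p) x * poly (map_poly of_rat q) x"
proof (induction p)
  case (pCons a p)
  then show ?case
    by (simp add: poly_map_of_rat_add poly_map_of_rat_smult map_poly_pCons algebra_simps)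
qed simp

lemma rat_adjoin_add: "a \<in> rat_adjoin \<mu> \<Longrightarrow> b \<in> rat_adjoin \<mu> \<Longrightarrow> a + b \<in> rat_adjoin \<mu>"
  unfolding rat_adjoin_def by (auto simp flip: poly_map_of_rat_add)

lemma rat_adjoin_mult: "a \<in> rat_adjoin \<mu> \<Longrightarrow> b \<in> rat_adjoin \<mu> \<Longrightarrow> a * b \<in> rat_adjoin \<mu>"
  unfolding rat_adjoin_def by (auto simp flip: poly_map_of_rat_mult)

lemma of_rat_in_rat_adjoin: "of_rat q \<in> rat_adjoin \<mu>"
proof -
  have "of_rat q = poly (map_poly of_rat [:q:]) \<mu>" by (simp add: map_poly_pCons)
  then show ?thesis unfolding rat_adjoin_def by blast
qed

lemma gen_in_rat_adjoin: "\<mu> \<in> rat_adjoin \<mu>"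
proof -
  have "\<mu> = poly (map_poly of_rat [:0, 1:]) \<mu>" by (simp add: map_poly_pCons)
  then show ?thesis unfolding rat_adjoin_def by blast
qed

lemma zero_in_rat_adjoin: "0 \<in> rat_adjoin \<mu>"
  and one_in_rat_adjoin: "1 \<in> rat_adjoin \<mu>"
  and minus_one_in_rat_adjoin: "-1 \<in> rat_adjoin \<mu>"
  using of_rat_in_rat_adjoin[of 0] of_rat_in_rat_adjoin[of 1] of_rat_in_rat_adjoin[of "-1"]
  by (auto simp: of_rat_minus)

section \<open>Nested partial sums\<close>

text \<open>The head of the list belongs to the largest summation index, so index lists get reversed.\<close>

fun nested_sum :: "(nat \<Rightarrow> 'a::comm_semiring_1) list \<Rightarrow> nat \<Rightarrow> 'a" where
  "nested_sum [] N = 1"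
| "nested_sum (f # fs) N = (\<Sum>n\<le>N. f n * nested_sum fs n)"

text \<open>The square of index pairs up to N is covered by two closed triangles; both contain the
  diagonal, hence the subtraction.\<close>

lemma prod_partial_sums:
  fixes p q :: "nat \<Rightarrow> 'a::comm_ring_1"
  shows "(\<Sum>n\<le>N. p n) * (\<Sum>n\<le>N. q n) =
    (\<Sum>n\<le>N. p n * (\<Sum>i\<le>n. q i)) + (\<Sum>n\<le>N. q n * (\<Sum>i\<le>n. p i)) - (\<Sum>n\<le>N. p n * q n)"
  by (induction N) (simp_all add: algebra_simps)

section \<open>Chains below N and series over all chains\<close>

definition chains_upto :: "nat \<Rightarrow> nat \<Rightarrow> nat list set" where
  "chains_upto r N = {l. length l = r \<and> sorted l \<and> set l \<subseteq> {..N}}"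

lemma finite_chains_upto: "finite (chains_upto r N)"
  by (rule finite_subset[OF _ finite_lists_length_eq[of "{..N}" r]]) (auto simp: chains_upto_def)

lemma chains_upto_0: "chains_upto 0 N = {[]}"
  by (auto simp: chains_upto_def)

text \<open>The last entry n of a weak chain is its largest, and what precedes it is an arbitrary
  chain below n.\<close>

lemma sum_chains_upto_Suc:
  "(\<Sum>l\<in>chains_upto (Suc r) N. F l) = (\<Sum>n\<le>N. \<Sum>l\<in>chains_upto r n. F (l @ [n]))"
proof -
  have "(\<Sum>n\<le>N. \<Sum>l\<in>chains_upto r n. F (l @ [n])) =
      (\<Sum>(n, l)\<in>Sigma {..N} (chains_upto r). F (l @ [n]))"
    by (rule sum.Sigma) (auto simp: finite_chains_upto)
  also have "\<dots> = (\<Sum>l\<in>chains_upto (Suc r) N. F l)"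
  proof (rule sum.reindex_bij_witness[where i = "\<lambda>l. (last l, butlast l)"
        and j = "\<lambda>(n, l). l @ [n]"], goal_cases)
    case (2 x)
    then show ?case
      by (cases x) (fastforce simp: chains_upto_def sorted_append)
  next
    case (3 l)
    then have "l \<noteq> []" by (auto simp: chains_upto_def)
    then show ?case by simp
  next
    case (4 l)
    then have l: "l \<noteq> []" "length l = Suc r" "sorted l" "set l \<subseteq> {..N}"
      by (auto simp: chains_upto_def)
    then have "sorted (butlast l @ [last l])" "set (butlast l @ [last l]) \<subseteq> {..N}" by simp_all
    then show ?case using l(2) by (auto simp: chains_upto_def sorted_append)
  qed auto
  finally show ?thesis by simp
qed

text \<open>Chains list the smallest index first while \<open>nested_sum\<close> starts with the
  largest, hence \<open>rev\<close>; the induction splits off the last index.\<close>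

lemma sum_chains_upto_eq_nested_sum:
  "(\<Sum>l\<in>chains_upto (length fs) N. \<Prod>i<length fs. (fs ! i) (l ! i)) = nested_sum (rev fs) N"
proof (induction fs arbitrary: N rule: rev_induct)
  case Nil
  then show ?case by (simp add: chains_upto_0)
next
  case (snoc f fs)
  have "(\<Prod>i<Suc (length fs). ((fs @ [f]) ! i) ((l @ [n]) ! i)) =
      f n * (\<Prod>i<length fs. (fs ! i) (l ! i))" if "l \<in> chains_upto (length fs) n" for l n
    using that by (auto simp: chains_upto_def nth_append mult.commute intro!: prod.cong)
  then have "(\<Sum>l\<in>chains_upto (length (fs @ [f])) N.
        \<Prod>i<length (fs @ [f]). ((fs @ [f]) ! i) (l ! i)) =
      (\<Sum>n\<le>N. f n * (\<Sum>l\<in>chains_upto (length fs) n. \<Prod>i<length fs. (fs ! i) (l ! i)))"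
    by (simp add: sum_chains_upto_Suc sum_distrib_left del: prod.lessThan_Suc)
  also have "\<dots> = nested_sum (rev (fs @ [f])) N"
    by (simp add: snoc.IH)
  finally show ?case .
qed

lemma last_weak_chain: "l \<in> weak_chains (Suc r) \<Longrightarrow> last l = l ! r"
  by (cases "l = []") (simp_all add: weak_chains_def last_conv_nth)

lemma finite_subset_chains_upto:
  assumes "finite F" "F \<subseteq> weak_chains r"
  shows "\<exists>N. F \<subseteq> chains_upto r N"
proof -
  have "finite (\<Union>l\<in>F. set l)" using assms by auto
  then obtain N where "(\<Union>l\<in>F. set l) \<subseteq> {..N}"
    by (meson finite_nat_iff_bounded_le)
  then show ?thesis using assms(2) by (auto simp: chains_upto_def weak_chains_def)
qed

text \<open>Bounded nested sums of norms give absolute summability, so the infinite sum can be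
  computed along the exhausting truncations \<open>chains_upto r N\<close>.\<close>

lemma nested_sum_tendsto_infsum:
  fixes fs :: "(nat \<Rightarrow> complex) list"
  assumes bound: "\<And>N. nested_sum (map (\<lambda>f n. norm (f n)) (rev fs)) N \<le> K"
  shows "nested_sum (rev fs) \<longlonglongrightarrow>
    (\<Sum>\<^sub>\<infinity>l\<in>weak_chains (length fs). \<Prod>i<length fs. (fs ! i) (l ! i))"
proof -
  define r where "r = length fs"
  define F where "F l = (\<Prod>i<r. (fs ! i) (l ! i))" for l
  have le: "(\<Sum>l\<in>chains_upto r N. norm (F l)) \<le> K" for N
  proof -
    have "(\<Sum>l\<in>chains_upto r N. norm (F l)) =
       (\<Sum>l\<in>chains_upto (length (map (\<lambda>f n. norm (f n)) fs)) N.
          \<Prod>i<length (map (\<lambda>f n. norm (f n)) fs). (map (\<lambda>f n. norm (f n)) fs ! i) (l ! i))"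
      by (simp add: F_def r_def flip: prod_norm)
    also have "\<dots> \<le> K"
      unfolding sum_chains_upto_eq_nested_sum using bound[of N] by (simp add: rev_map)
    finally show ?thesis .
  qed
  have "(\<lambda>l. norm (F l)) summable_on weak_chains r"
  proof (rule nonneg_bdd_above_summable_on)
    show "bdd_above (sum (\<lambda>l. norm (F l)) ` {A. A \<subseteq> weak_chains r \<and> finite A})"
    proof (rule bdd_aboveI2, clarify)
      fix A assume "A \<subseteq> weak_chains r" "finite A"
      then obtain N where "A \<subseteq> chains_upto r N" using finite_subset_chains_upto by blast
      then have "(\<Sum>l\<in>A. norm (F l)) \<le> (\<Sum>l\<in>chains_upto r N. norm (F l))"
        by (intro sum_mono2 finite_chains_upto) auto
      also have "\<dots> \<le> K" by (rule le)
      finally show "(\<Sum>l\<in>A. norm (F l)) \<le> K" .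
    qed
  qed simp
  then have "F summable_on weak_chains r" by (rule abs_summable_summable)
  then have "(sum F \<longlongrightarrow> infsum F (weak_chains r)) (finite_subsets_at_top (weak_chains r))"
    using has_sum_infsum has_sum_def by blast
  \<comment> \<open>Every finite set of chains lies in some truncation and in all later ones, so the
    truncations are cofinal among the finite subsets.\<close>
  moreover have "filterlim (chains_upto r) (finite_subsets_at_top (weak_chains r)) sequentially"
    unfolding filterlim_finite_subsets_at_top
  proof (intro allI impI)
    fix A assume A: "finite A \<and> A \<subseteq> weak_chains r"
    then obtain N where N: "A \<subseteq> chains_upto r N" using finite_subset_chains_upto by blast
    have "A \<subseteq> chains_upto r M" if "M \<ge> N" for M
      using N that by (force simp: chains_upto_def)
    then show "\<forall>\<^sub>F M in sequentially. finite (chains_upto r M) \<and> A \<subseteq> chains_upto r M \<and>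
        chains_upto r M \<subseteq> weak_chains r"
      unfolding eventually_sequentially
      by (intro exI[of _ N]) (auto simp: finite_chains_upto, auto simp: chains_upto_def weak_chains_def)
  qed
  ultimately have "(\<lambda>N. sum F (chains_upto r N)) \<longlonglongrightarrow> infsum F (weak_chains r)"
    by (rule filterlim_compose)
  moreover have "(\<lambda>N. sum F (chains_upto r N)) = nested_sum (rev fs)"
    by (simp add: fun_eq_iff F_def r_def sum_chains_upto_eq_nested_sum)
  ultimately show ?thesis by (simp add: F_def [abs_def] r_def)
qed

section \<open>Growth bounds\<close>

lemma sum_inverse_sqrt_le: "(\<Sum>n\<le>N. 1 / sqrt (real n + 1)) \<le> 2 * sqrt (real N + 1)"
proof (induction N)
  case (Suc N)
  define a b where "a = sqrt (real N + 1)" and "b = sqrt (real N + 2)"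
  have ab: "a > 0" "b > 0" "a\<^sup>2 = real N + 1" "b\<^sup>2 = real N + 2" by (auto simp: a_def b_def)
  \<comment> \<open>Since \<open>a\<^sup>2 = b\<^sup>2 - 1\<close>, expanding the square gives
    \<open>2 * a * b + 1 \<le> 2 * b\<^sup>2\<close>, the induction step multiplied by
    \<open>b\<close>.\<close>
  have "0 \<le> (a - b)\<^sup>2" by simp
  also have "\<dots> = 2 * b\<^sup>2 - 1 - 2 * a * b" using ab by (simp add: power2_diff)
  finally have "2 * a + 1 / b \<le> 2 * b"
    using ab by (simp add: field_simps power2_eq_square)
  then show ?case using Suc by (simp add: a_def b_def add.commute add.left_commute)
qed simp

lemma nested_sum_norm_nonneg:
  "nested_sum (map (\<lambda>f n. norm (f n :: complex)) fs) N \<ge> 0"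
  by (induction fs arbitrary: N) (auto intro!: sum_nonneg mult_nonneg_nonneg)

text \<open>The square root reproduces itself: O(1/(n+1)) times O(sqrt(n+1)) is O(1/sqrt(n+1)),
  whose partial sums are O(sqrt(N+1)). One shape of bound thus serves every depth.\<close>

lemma nested_sum_sqrt_bound:
  assumes "\<And>f. f \<in> set fs \<Longrightarrow> \<exists>K. \<forall>n. norm (f n :: complex) \<le> K / (real n + 1)"
  shows "\<exists>K. \<forall>N. nested_sum (map (\<lambda>f n. norm (f n)) fs) N \<le> K * sqrt (real N + 1)"
  using assms
proof (induction fs)
  case Nil
  show ?case by (intro exI[of _ 1]) auto
next
  case (Cons f fs)
  obtain K where K: "\<And>N. nested_sum (map (\<lambda>f n. norm (f n)) fs) N \<le> K * sqrt (real N + 1)"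
    using Cons by auto
  obtain K' where K': "\<And>n. norm (f n) \<le> K' / (real n + 1)"
    using Cons.prems[of f] by auto
  \<comment> \<open>Reading the bounds at 0 shows that the constants are nonnegative, which
    multiplying the estimates requires.\<close>
  have "0 \<le> norm (f 0)" by simp
  also have "norm (f 0) \<le> K'" using K'[of 0] by simp
  finally have K'0: "0 \<le> K'" .
  have K0: "0 \<le> K" using order_trans[OF nested_sum_norm_nonneg K[of 0]] by simp
  have step: "norm (f n) * nested_sum (map (\<lambda>f n. norm (f n)) fs) n \<le> K' * K * (1 / sqrt (real n + 1))"
    for n
  proof -
    have "norm (f n) * nested_sum (map (\<lambda>f n. norm (f n)) fs) n \<le>
        K' / (real n + 1) * (K * sqrt (real n + 1))"
      using K'0 by (intro mult_mono K K' nested_sum_norm_nonneg) auto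
    also have "\<dots> = K' * K * (sqrt (real n + 1) / (real n + 1))" by simp
    also have "sqrt (real n + 1) / (real n + 1) = 1 / sqrt (real n + 1)"
      by (simp add: divide_simps)
    finally show ?thesis .
  qed
  have "nested_sum (map (\<lambda>f n. norm (f n)) (f # fs)) N \<le> (2 * K' * K) * sqrt (real N + 1)" for N
  proof -
    have "nested_sum (map (\<lambda>f n. norm (f n)) (f # fs)) N \<le> (\<Sum>n\<le>N. K' * K * (1 / sqrt (real n + 1)))"
      by (simp only: list.map nested_sum.simps) (intro sum_mono step)
    also have "\<dots> = K' * K * (\<Sum>n\<le>N. 1 / sqrt (real n + 1))" by (simp only: sum_distrib_left)
    also have "\<dots> \<le> K' * K * (2 * sqrt (real N + 1))"
      using K'0 K0 by (intro mult_left_mono sum_inverse_sqrt_le) auto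
    finally show ?thesis by simp
  qed
  then show ?case by blast
qed

text \<open>Quadratic decay of \<open>g\<close> against square-root growth of the inner sums leaves
  the exponent 1/2 - 2 = -3/2, which is below -1.\<close>

lemma nested_sum_bounded:
  assumes "\<And>f. f \<in> set fs \<Longrightarrow> \<exists>K. \<forall>n. norm (f n :: complex) \<le> K / (real n + 1)"
    and "\<And>n. norm (g n) \<le> K' / (real n + 1)\<^sup>2"
  shows "\<exists>K. \<forall>N. nested_sum (map (\<lambda>f n. norm (f n)) (g # fs)) N \<le> K"
proof -
  obtain K where K: "\<And>N. nested_sum (map (\<lambda>f n. norm (f n)) fs) N \<le> K * sqrt (real N + 1)"
    using nested_sum_sqrt_bound[OF assms(1)] by blast
  have "0 \<le> norm (g 0)" by simp
  also have "norm (g 0) \<le> K'" using assms(2)[of 0] by simp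
  finally have K'0: "0 \<le> K'" .
  have K0: "0 \<le> K" using order_trans[OF nested_sum_norm_nonneg K[of 0]] by simp
  define s where "s n = real (Suc n) powr (-3/2)" for n
  have "summable (\<lambda>n. real n powr (-3/2))" by (subst summable_real_powr_iff) simp
  have s_nonneg: "s n \<ge> 0" for n by (simp add: s_def)
  from \<open>summable (\<lambda>n. real n powr (-3/2))\<close> have s: "summable s" unfolding s_def by (subst summable_Suc_iff)
  have step: "norm (g n) * nested_sum (map (\<lambda>f n. norm (f n)) fs) n \<le> K' * K * s n" for n
  proof -
    have "norm (g n) * nested_sum (map (\<lambda>f n. norm (f n)) fs) n \<le>
        K' / (real n + 1)\<^sup>2 * (K * sqrt (real n + 1))"
      using K'0 by (intro mult_mono K assms(2) nested_sum_norm_nonneg) auto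
    also have "\<dots> = K' * K * (sqrt (real n + 1) / (real n + 1)\<^sup>2)" by simp
    also have "sqrt (real n + 1) / (real n + 1)\<^sup>2 = real (Suc n) powr (1/2) / real (Suc n) powr 2"
      by (simp add: powr_half_sqrt add.commute)
    also have "\<dots> = s n" unfolding s_def powr_diff[symmetric] by simp
    finally show ?thesis .
  qed
  have "nested_sum (map (\<lambda>f n. norm (f n)) (g # fs)) N \<le> K' * K * suminf s" for N
  proof -
    have "nested_sum (map (\<lambda>f n. norm (f n)) (g # fs)) N \<le> (\<Sum>n\<le>N. K' * K * s n)"
      by (simp only: list.map nested_sum.simps) (intro sum_mono step)
    also have "\<dots> = K' * K * (\<Sum>n\<le>N. s n)" by (simp only: sum_distrib_left)
    also have "\<dots> \<le> K' * K * suminf s"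
      using K'0 K0 s by (intro mult_left_mono sum_le_suminf) (auto simp: s_nonneg)
    finally show ?thesis .
  qed
  then show ?thesis by blast
qed

section \<open>The summands and their partial fractions\<close>

text \<open>Each summation index carries one of the r factors \<open>\<mu>\<close>, so a product of
  two terms has a surplus \<open>\<mu>\<close>, which the coefficient ring absorbs. Order 0, the
  constant \<open>\<mu>\<close>, turns up in partial fractions.\<close>

definition hurwitz_term :: "complex \<Rightarrow> nat \<Rightarrow> rat \<Rightarrow> nat \<Rightarrow> complex" where
  "hurwitz_term \<mu> k m n = \<mu> / (of_nat n * \<mu> + of_rat m) ^ k"

definition inner_terms :: "complex \<Rightarrow> (nat \<Rightarrow> complex) set" where
  "inner_terms \<mu> = {hurwitz_term \<mu> k m | k m. k \<ge> 1 \<and> m > 0}"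

text \<open>A single term of order 1 decays only like 1/n; it enters through differences, whose
  leading parts cancel.\<close>

definition outer_terms :: "complex \<Rightarrow> (nat \<Rightarrow> complex) set" where
  "outer_terms \<mu> = {hurwitz_term \<mu> k m | k m. k \<ge> 2 \<and> m > 0} \<union>
     {\<lambda>n. hurwitz_term \<mu> 1 m n - hurwitz_term \<mu> 1 m' n | m m'. m > 0 \<and> m' > 0 \<and> m \<noteq> m'}"

text \<open>These sequences may diverge; they are used as weights below an outer summand.\<close>

definition inner_sums :: "complex \<Rightarrow> (nat \<Rightarrow> complex) set" where
  "inner_sums \<mu> = {nested_sum fs | fs. set fs \<subseteq> inner_terms \<mu>}"

definition outer_sums :: "complex \<Rightarrow> (nat \<Rightarrow> complex) set" where
  "outer_sums \<mu> = {\<lambda>_. 1} \<union>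
     {nested_sum (f # fs) | f fs. f \<in> outer_terms \<mu> \<and> set fs \<subseteq> inner_terms \<mu>}"

lemma hurwitz_term_outer: "k \<ge> 2 \<Longrightarrow> m > 0 \<Longrightarrow> hurwitz_term \<mu> k m \<in> outer_terms \<mu>"
  unfolding outer_terms_def by blast

lemma hurwitz_term_diff_outer:
  "m > 0 \<Longrightarrow> m' > 0 \<Longrightarrow> m \<noteq> m' \<Longrightarrow>
     (\<lambda>n. hurwitz_term \<mu> 1 m n - hurwitz_term \<mu> 1 m' n) \<in> outer_terms \<mu>"
  unfolding outer_terms_def by blast

text \<open>In a product of two sums the outermost summand of one factor may end up below that of
  the other, where it must count as inner.\<close>

lemma outer_terms_subset_span: "outer_terms \<mu> \<subseteq> fun_span (rat_adjoin \<mu>) (inner_terms \<mu>)"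
proof -
  have h: "hurwitz_term \<mu> k m \<in> fun_span (rat_adjoin \<mu>) (inner_terms \<mu>)" if "k \<ge> 1" "m > 0" for k m
    using that by (intro fun_span_base) (auto simp: inner_terms_def)
  show ?thesis
    by (auto simp: outer_terms_def intro!: h fun_span_diff minus_one_in_rat_adjoin)
qed

section \<open>The generators of \<open>Z_mu\<close> and its module operations\<close>

definition Z_gens :: "complex \<Rightarrow> complex set" where
  "Z_gens \<mu> = {1} \<union> {zeta_mu \<mu> k m | k m. admissible k m}
     \<union> {D_mu \<mu> k m m' | k m m'. special_triple k m m'}"

lemma Z_mu_eq: "Z_mu \<mu> = span_over (rat_adjoin \<mu>) (Z_gens \<mu>)"
  by (simp add: Z_mu_def Z_gens_def)

lemma Z_mu_add: "x \<in> Z_mu \<mu> \<Longrightarrow> y \<in> Z_mu \<mu> \<Longrightarrow> x + y \<in> Z_mu \<mu>"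
  unfolding Z_mu_eq by (intro span_over_add zero_in_rat_adjoin rat_adjoin_add)

lemma Z_mu_scale: "c \<in> rat_adjoin \<mu> \<Longrightarrow> x \<in> Z_mu \<mu> \<Longrightarrow> c * x \<in> Z_mu \<mu>"
  unfolding Z_mu_eq by (intro span_over_scale rat_adjoin_mult)

lemma Z_gens_subset: "Z_gens \<mu> \<subseteq> Z_mu \<mu>"
  unfolding Z_mu_eq using span_over_base one_in_rat_adjoin by blast

section \<open>Decay and partial fractions for \<open>\<mu>\<close> in the right half-plane\<close>

context
  fixes \<mu> :: complex
  assumes mu: "Re \<mu> > 0"
begin

text \<open>The modulus dominates the real part, which is n \<open>Re \<mu>\<close> + m.\<close>

lemma denominator_lower_bound:
  assumes "m > 0"
  shows "min (Re \<mu>) (of_rat m) * (real n + 1) \<le> norm (of_nat n * \<mu> + of_rat m)"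
proof -
  have Re_m: "Re (of_rat m) = of_rat m" for m
    by (cases m) (simp add: of_rat_rat)
  have "min (Re \<mu>) (of_rat m) * (real n + 1) =
      real n * min (Re \<mu>) (of_rat m) + min (Re \<mu>) (of_rat m)" by (simp add: algebra_simps)
  also have "\<dots> \<le> real n * Re \<mu> + of_rat m"
    by (intro add_mono mult_left_mono) auto
  also have "\<dots> = Re (of_nat n * \<mu> + of_rat m)" by (simp add: Re_m)
  also have "\<dots> \<le> norm (of_nat n * \<mu> + of_rat m)" by (rule complex_Re_le_cmod)
  finally show ?thesis .
qed

lemma denominator_nonzero: "m > 0 \<Longrightarrow> of_nat n * \<mu> + of_rat m \<noteq> 0"
  using denominator_lower_bound[of m n] mu
  by (smt (verit) mult_pos_pos norm_zero of_nat_0_le_iff zero_less_of_rat_iff)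

text \<open>The exponent \<open>j\<close> is left free so that j = 1 serves inner terms and j = 2
  outer ones.\<close>

lemma hurwitz_term_bound:
  assumes "m > 0" "j \<le> k"
  shows "\<exists>K. \<forall>n. norm (hurwitz_term \<mu> k m n) \<le> K / (real n + 1) ^ j"
proof -
  define d where "d = min (Re \<mu>) (of_rat m)"
  have d: "d > 0" using mu assms by (simp add: d_def)
  have "norm (hurwitz_term \<mu> k m n) \<le> (norm \<mu> / d ^ k) / (real n + 1) ^ j" for n
  proof -
    have "d ^ k * (real n + 1) ^ j \<le> d ^ k * (real n + 1) ^ k"
      using d assms by (intro mult_left_mono power_increasing) auto
    also have "\<dots> = (d * (real n + 1)) ^ k" by (simp add: power_mult_distrib)
    also have "\<dots> \<le> norm (of_nat n * \<mu> + of_rat m) ^ k"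
      using denominator_lower_bound[OF assms(1), of n] d by (intro power_mono) (auto simp: d_def)
    finally have "norm \<mu> / norm (of_nat n * \<mu> + of_rat m) ^ k \<le> norm \<mu> / (d ^ k * (real n + 1) ^ j)"
      using d by (intro divide_left_mono) (auto intro!: mult_pos_pos zero_less_power simp: denominator_nonzero assms)
    then show ?thesis by (simp add: hurwitz_term_def norm_divide norm_power)
  qed
  then show ?thesis by blast
qed

text \<open>The right side is the outermost factor of the \<open>D_mu\<close> summand together with
  the prefactor of that series.\<close>

lemma hurwitz_term_diff:
  assumes "m > 0" "m' > 0"
  shows "hurwitz_term \<mu> 1 m n - hurwitz_term \<mu> 1 m' n =
    of_rat (m' - m) * (\<mu> / ((of_nat n * \<mu> + of_rat m) * (of_nat n * \<mu> + of_rat m')))"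
  using denominator_nonzero[OF assms(1), of n] denominator_nonzero[OF assms(2), of n]
  by (simp add: hurwitz_term_def of_rat_diff field_simps)

lemma inner_term_bound:
  assumes "f \<in> inner_terms \<mu>"
  shows "\<exists>K. \<forall>n. norm (f n) \<le> K / (real n + 1)"
  using assms hurwitz_term_bound[of _ 1] by (auto simp: inner_terms_def)

lemma outer_term_bound:
  assumes "f \<in> outer_terms \<mu>"
  shows "\<exists>K. \<forall>n. norm (f n) \<le> K / (real n + 1)\<^sup>2"
  using assms unfolding outer_terms_def
proof (elim UnE CollectE exE conjE)
  fix k m assume "f = hurwitz_term \<mu> k m" "k \<ge> 2" "m > 0"
  then show ?thesis using hurwitz_term_bound by blast
next
  fix m m' :: rat
  assume f: "f = (\<lambda>n. hurwitz_term \<mu> 1 m n - hurwitz_term \<mu> 1 m' n)" and m: "m > 0" "m' > 0"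
  obtain K where K: "\<And>n. norm (hurwitz_term \<mu> 1 m n) \<le> K / (real n + 1)"
    using hurwitz_term_bound[of m 1 1] m by auto
  obtain K' where K': "\<And>n. norm (hurwitz_term \<mu> 1 m' n) \<le> K' / (real n + 1)"
    using hurwitz_term_bound[of m' 1 1] m by auto
  \<comment> \<open>The product of two terms contains \<open>\<mu>\<close> twice, their difference
    only once; hence the division by \<open>\<mu>\<close>.\<close>
  define c :: complex where "c = of_rat (m' - m) / \<mu>"
  have "\<mu> \<noteq> 0" using mu by auto
  have "norm (f n) \<le> norm c * K * K' / (real n + 1)\<^sup>2" for n
  proof -
    have "f n = c * (hurwitz_term \<mu> 1 m n * hurwitz_term \<mu> 1 m' n)"
      unfolding f hurwitz_term_diff[OF m] using \<open>\<mu> \<noteq> 0\<close> by (simp add: hurwitz_term_def c_def)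
    then have "norm (f n) = norm c * (norm (hurwitz_term \<mu> 1 m n) * norm (hurwitz_term \<mu> 1 m' n))"
      by (simp add: norm_mult)
    also have "\<dots> \<le> norm c * (K / (real n + 1) * (K' / (real n + 1)))"
      using order_trans[OF norm_ge_zero K] by (intro mult_left_mono mult_mono K K') auto
    finally show ?thesis by (simp add: power2_eq_square)
  qed
  then show ?thesis by blast
qed

text \<open>The denominators X and Y differ by m' - m, independently of n. Expanding (Y - X)/(Y - X)
  in the numerator cancels one power of Y in one part and one of X in the other.\<close>

lemma hurwitz_term_partial_fraction:
  assumes "m > 0" "m' > 0" "m \<noteq> m'"
  shows "hurwitz_term \<mu> (Suc a) m n * hurwitz_term \<mu> (Suc b) m' n =
    of_rat (1 / (m' - m)) *
      (hurwitz_term \<mu> (Suc a) m n * hurwitz_term \<mu> b m' n -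
       hurwitz_term \<mu> a m n * hurwitz_term \<mu> (Suc b) m' n)"
proof -
  define X :: complex where "X = of_nat n * \<mu> + of_rat m"
  define Y :: complex where "Y = of_nat n * \<mu> + of_rat m'"
  have nz: "X \<noteq> 0" "Y \<noteq> 0" "Y - X \<noteq> 0"
    using assms denominator_nonzero by (auto simp: X_def Y_def)
  have "(of_rat (1 / (m' - m)) :: complex) = 1 / (Y - X)" by (simp add: X_def Y_def of_rat_divide of_rat_diff)
  moreover have "\<mu> / X ^ Suc a * (\<mu> / Y ^ Suc b) = 1 / (Y - X) *
      (\<mu> / X ^ Suc a * (\<mu> / Y ^ b) - \<mu> / X ^ a * (\<mu> / Y ^ Suc b))"
    using nz by (simp add: divide_simps) (simp add: algebra_simps)
  ultimately show ?thesis
    unfolding hurwitz_term_def X_def[symmetric] Y_def[symmetric] by simp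
qed

lemma hurwitz_term_mult_in_span:
  assumes "m > 0" "m' > 0"
  shows "(\<lambda>n. hurwitz_term \<mu> (Suc a) m n * hurwitz_term \<mu> (Suc b) m' n)
    \<in> fun_span (rat_adjoin \<mu>) (outer_terms \<mu>)" (is "_ \<in> ?S")
proof (cases "m = m'")
  case True
  have "hurwitz_term \<mu> (Suc a + Suc b) m \<in> ?S"
    using assms by (intro fun_span_base hurwitz_term_outer) auto
  then have "(\<lambda>n. \<mu> * hurwitz_term \<mu> (Suc a + Suc b) m n) \<in> ?S"
    by (intro fun_span_scale gen_in_rat_adjoin)
  then show ?thesis using True by (simp add: hurwitz_term_def mult_ac flip: power_add)
next
  case False
  have mu_pow: "(\<lambda>n. \<mu> * hurwitz_term \<mu> k m n) \<in> ?S" if "k \<ge> 2" "m > 0" for k m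
    using that by (intro fun_span_scale gen_in_rat_adjoin fun_span_base hurwitz_term_outer)
  have h0: "hurwitz_term \<mu> 0 m n = \<mu>" for m n by (simp add: hurwitz_term_def)
  \<comment> \<open>The induction runs on the bracket of the partial fraction: for a = b = 0 it is
    \<open>\<mu>\<close> times a difference of order-1 terms, whose members singly decay too slowly
    to lie in the span.\<close>
  have "(\<lambda>n. hurwitz_term \<mu> (Suc a) m n * hurwitz_term \<mu> b m' n -
         hurwitz_term \<mu> a m n * hurwitz_term \<mu> (Suc b) m' n) \<in> ?S" for a b
  proof (induction "a + b" arbitrary: a b rule: less_induct)
    case less
    have IH: "(\<lambda>n. hurwitz_term \<mu> (Suc a') m n * hurwitz_term \<mu> (Suc b') m' n) \<in> ?S"
      if "a' + b' < a + b" for a' b'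
      unfolding hurwitz_term_partial_fraction[OF assms False]
      using less[OF that] by (intro fun_span_scale of_rat_in_rat_adjoin)
    show ?case
    proof (cases a; cases b)
      assume "a = 0" "b = 0"
      moreover have "(\<lambda>n. \<mu> * (hurwitz_term \<mu> 1 m n - hurwitz_term \<mu> 1 m' n)) \<in> ?S"
        using assms False
        by (intro fun_span_scale gen_in_rat_adjoin fun_span_base hurwitz_term_diff_outer)
      ultimately show ?thesis by (simp add: h0 algebra_simps)
    next
      \<comment> \<open>The order-0 factor is the constant \<open>\<mu>\<close>, so the second
        member is \<open>\<mu>\<close> times a term of order \<open>Suc b\<close>, at least 2; the
        first is a smaller product.\<close>
      fix b' assume "a = 0" "b = Suc b'"
      then show ?thesis
        using IH[of 0 b'] mu_pow[of "Suc b" m'] assms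
        by (auto simp: h0 intro!: fun_span_diff minus_one_in_rat_adjoin)
    next
      fix a' assume "a = Suc a'" "b = 0"
      then show ?thesis
        using IH[of a' 0] mu_pow[of "Suc a" m] assms
        by (auto simp: h0 mult.commute[of _ \<mu>] intro!: fun_span_diff minus_one_in_rat_adjoin)
    next
      fix a' b' assume "a = Suc a'" "b = Suc b'"
      then show ?thesis
        using IH[of a b'] IH[of a' b]
        by (auto intro!: fun_span_diff minus_one_in_rat_adjoin)
    qed
  qed
  then show ?thesis
    unfolding hurwitz_term_partial_fraction[OF assms False]
    by (intro fun_span_scale of_rat_in_rat_adjoin)
qed

text \<open>The gain from inner to outer makes the diagonal sums in a product of nested sums
  converge.\<close>

lemma inner_span_mult:
  assumes "f \<in> fun_span (rat_adjoin \<mu>) (inner_terms \<mu>)" "g \<in> fun_span (rat_adjoin \<mu>) (inner_terms \<mu>)"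
  shows "(\<lambda>n. f n * g n) \<in> fun_span (rat_adjoin \<mu>) (outer_terms \<mu>)"
  using assms
proof (rule fun_span_bilinear[where \<Phi> = "\<lambda>f g n. f n * g n"])
  fix f g assume "f \<in> inner_terms \<mu>" "g \<in> inner_terms \<mu>"
  then obtain a m b m' where "f = hurwitz_term \<mu> a m" "g = hurwitz_term \<mu> b m'"
    "a \<ge> 1" "b \<ge> 1" "m > 0" "m' > 0" unfolding inner_terms_def by blast
  then show "(\<lambda>n. f n * g n) \<in> fun_span (rat_adjoin \<mu>) (outer_terms \<mu>)"
    using hurwitz_term_mult_in_span[of m m' "a - 1" "b - 1"] by simp
qed (auto simp: algebra_simps)

section \<open>Products of nested sums\<close>

text \<open>Prefixing a summand to a nested sum, extended bilinearly, because products yield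
  combinations in both places.\<close>

lemma inner_span_summation:
  assumes "f \<in> fun_span (rat_adjoin \<mu>) (inner_terms \<mu>)" "b \<in> fun_span (rat_adjoin \<mu>) (inner_sums \<mu>)"
  shows "(\<lambda>N. \<Sum>n\<le>N. f n * b n) \<in> fun_span (rat_adjoin \<mu>) (inner_sums \<mu>)"
  using assms
proof (rule fun_span_bilinear[where \<Phi> = "\<lambda>f b N. \<Sum>n\<le>N. f n * b n"])
  fix f b assume "f \<in> inner_terms \<mu>" "b \<in> inner_sums \<mu>"
  then obtain fs where "b = nested_sum fs" "set (f # fs) \<subseteq> inner_terms \<mu>"
    by (auto simp: inner_sums_def)
  then have "(\<lambda>N. \<Sum>n\<le>N. f n * b n) = nested_sum (f # fs)" "nested_sum (f # fs) \<in> inner_sums \<mu>"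
    unfolding inner_sums_def by (simp add: fun_eq_iff, blast)
  then show "(\<lambda>N. \<Sum>n\<le>N. f n * b n) \<in> fun_span (rat_adjoin \<mu>) (inner_sums \<mu>)"
    by (auto intro: fun_span_base)
qed (auto simp: algebra_simps sum.distrib sum_distrib_left)

lemma outer_span_summation:
  assumes "f \<in> fun_span (rat_adjoin \<mu>) (outer_terms \<mu>)" "b \<in> fun_span (rat_adjoin \<mu>) (inner_sums \<mu>)"
  shows "(\<lambda>N. \<Sum>n\<le>N. f n * b n) \<in> fun_span (rat_adjoin \<mu>) (outer_sums \<mu>)"
  using assms
proof (rule fun_span_bilinear[where \<Phi> = "\<lambda>f b N. \<Sum>n\<le>N. f n * b n"])
  fix f b assume "f \<in> outer_terms \<mu>" "b \<in> inner_sums \<mu>"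
  then obtain fs where "b = nested_sum fs" "f \<in> outer_terms \<mu>" "set fs \<subseteq> inner_terms \<mu>"
    by (auto simp: inner_sums_def)
  then have "(\<lambda>N. \<Sum>n\<le>N. f n * b n) = nested_sum (f # fs)" "nested_sum (f # fs) \<in> outer_sums \<mu>"
    unfolding outer_sums_def by (simp add: fun_eq_iff, blast)
  then show "(\<lambda>N. \<Sum>n\<le>N. f n * b n) \<in> fun_span (rat_adjoin \<mu>) (outer_sums \<mu>)"
    by (auto intro: fun_span_base)
qed (auto simp: algebra_simps sum.distrib sum_distrib_left)

text \<open>This is the quasi-shuffle recursion; weak inequalities give the diagonal its minus sign.
  Every product left under a sum has lost at least one entry.\<close>

lemma nested_sum_Cons_mult_Cons:
  "nested_sum (f # fs) N * nested_sum (g # gs) N =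
     (\<Sum>n\<le>N. f n * (nested_sum fs n * nested_sum (g # gs) n)) +
     (\<Sum>n\<le>N. g n * (nested_sum (f # fs) n * nested_sum gs n)) -
     (\<Sum>n\<le>N. (f n * g n) * (nested_sum fs n * nested_sum gs n))"
  for f g :: "nat \<Rightarrow> complex"
  using prod_partial_sums[of "\<lambda>n. f n * nested_sum fs n" N "\<lambda>n. g n * nested_sum gs n"]
  by (simp add: mult_ac)

text \<open>Nested induction along the quasi-shuffle recursion: the outer hypothesis, for all
  \<open>gs\<close>, handles the products with \<open>fs\<close>, the inner one the product of
  \<open>f # fs\<close> with \<open>gs\<close>.\<close>

lemma nested_sum_inner_mult:
  assumes "set fs \<subseteq> inner_terms \<mu>" "set gs \<subseteq> inner_terms \<mu>"
  shows "(\<lambda>N. nested_sum fs N * nested_sum gs N) \<in> fun_span (rat_adjoin \<mu>) (inner_sums \<mu>)"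
  using assms
proof (induction fs arbitrary: gs)
  case Nil
  then show ?case by (auto simp: inner_sums_def intro!: fun_span_base)
next
  case (Cons f fs)
  note outer_IH = Cons.IH and fs = Cons.prems(1)
  show ?case using Cons.prems(2)
  proof (induction gs)
    case Nil
    have "nested_sum (f # fs) \<in> inner_sums \<mu>" using fs unfolding inner_sums_def by blast
    then show ?case by (auto intro!: fun_span_base simp del: nested_sum.simps(2))
  next
    case (Cons g gs)
    have f: "f \<in> fun_span (rat_adjoin \<mu>) (inner_terms \<mu>)"
      and g: "g \<in> fun_span (rat_adjoin \<mu>) (inner_terms \<mu>)"
      using fs Cons.prems by (auto intro: fun_span_base)
    have fg: "(\<lambda>n. f n * g n) \<in> fun_span (rat_adjoin \<mu>) (inner_terms \<mu>)"
      using inner_span_mult[OF f g] outer_terms_subset_span by (rule fun_span_mono)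
    show ?case
      unfolding nested_sum_Cons_mult_Cons using fs Cons f g fg
      by (intro fun_span_diff fun_span_add inner_span_summation minus_one_in_rat_adjoin outer_IH)
        auto
  qed
qed

lemma inner_sums_span_mult:
  assumes "b \<in> fun_span (rat_adjoin \<mu>) (inner_sums \<mu>)" "c \<in> fun_span (rat_adjoin \<mu>) (inner_sums \<mu>)"
  shows "(\<lambda>n. b n * c n) \<in> fun_span (rat_adjoin \<mu>) (inner_sums \<mu>)"
  using assms
proof (rule fun_span_bilinear[where \<Phi> = "\<lambda>f g n. f n * g n"])
  fix b c assume "b \<in> inner_sums \<mu>" "c \<in> inner_sums \<mu>"
  then show "(\<lambda>n. b n * c n) \<in> fun_span (rat_adjoin \<mu>) (inner_sums \<mu>)"
    using nested_sum_inner_mult unfolding inner_sums_def[of \<mu>] by blast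
qed (auto simp: algebra_simps)

text \<open>One quasi-shuffle step suffices: the outermost summands f, g and f g all lie in the
  outer span, and what stands below them is a product of inner sums.\<close>

lemma outer_sums_span_mult:
  assumes "b \<in> fun_span (rat_adjoin \<mu>) (outer_sums \<mu>)" "c \<in> fun_span (rat_adjoin \<mu>) (outer_sums \<mu>)"
  shows "(\<lambda>n. b n * c n) \<in> fun_span (rat_adjoin \<mu>) (outer_sums \<mu>)"
  using assms
proof (rule fun_span_bilinear[where \<Phi> = "\<lambda>f g n. f n * g n"])
  fix b c assume bc: "b \<in> outer_sums \<mu>" "c \<in> outer_sums \<mu>"
  show "(\<lambda>n. b n * c n) \<in> fun_span (rat_adjoin \<mu>) (outer_sums \<mu>)"
  proof (cases "b = (\<lambda>_. 1) \<or> c = (\<lambda>_. 1)")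
    case True
    then show ?thesis using bc by (auto intro: fun_span_base)
  next
    case False
    then obtain f fs g gs where b: "b = nested_sum (f # fs)" and c: "c = nested_sum (g # gs)"
      and f: "f \<in> outer_terms \<mu>" and g: "g \<in> outer_terms \<mu>"
      and fs: "set fs \<subseteq> inner_terms \<mu>" and gs: "set gs \<subseteq> inner_terms \<mu>"
      using bc unfolding outer_sums_def by blast
    have f': "f \<in> fun_span (rat_adjoin \<mu>) (inner_terms \<mu>)"
      and g': "g \<in> fun_span (rat_adjoin \<mu>) (inner_terms \<mu>)"
      using f g outer_terms_subset_span by auto
    have FS: "nested_sum fs \<in> fun_span (rat_adjoin \<mu>) (inner_sums \<mu>)"
      and GS: "nested_sum gs \<in> fun_span (rat_adjoin \<mu>) (inner_sums \<mu>)"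
      using fs gs by (auto intro!: fun_span_base simp: inner_sums_def)
    \<comment> \<open>Whole factors recur below the other's outermost summand; there their
      truncations are expanded into inner sums.\<close>
    have B: "nested_sum (f # fs) \<in> fun_span (rat_adjoin \<mu>) (inner_sums \<mu>)"
      using inner_span_summation[OF f' FS] by (simp add: nested_sum.simps(2)[abs_def])
    have C: "nested_sum (g # gs) \<in> fun_span (rat_adjoin \<mu>) (inner_sums \<mu>)"
      using inner_span_summation[OF g' GS] by (simp add: nested_sum.simps(2)[abs_def])
    show ?thesis
      unfolding b c nested_sum_Cons_mult_Cons
      by (intro fun_span_diff fun_span_add outer_span_summation minus_one_in_rat_adjoin
          inner_sums_span_mult FS GS B C inner_span_mult f' g' fun_span_base[OF f] fun_span_base[OF g])
  qed
qed (auto simp: algebra_simps)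

section \<open>Passing to the limit\<close>

text \<open>The growth bounds supply absolute convergence. The last index is kept apart so that
  \<open>f\<close> can be a term or a difference.\<close>

lemma outer_sum_tendsto_infsum:
  assumes "f \<in> outer_terms \<mu>" "set fs \<subseteq> inner_terms \<mu>"
  shows "nested_sum (f # rev fs) \<longlonglongrightarrow> (\<Sum>\<^sub>\<infinity>l\<in>weak_chains (Suc (length fs)).
           (\<Prod>i<length fs. (fs ! i) (l ! i)) * f (last l))"
proof -
  obtain K where K: "\<And>n. norm (f n) \<le> K / (real n + 1)\<^sup>2"
    using outer_term_bound[OF assms(1)] by blast
  have "\<exists>K. \<forall>N. nested_sum (map (\<lambda>f n. norm (f n)) (f # rev fs)) N \<le> K"
    by (rule nested_sum_bounded[OF _ K]) (use assms(2) inner_term_bound in auto)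
  then obtain K where "\<And>N. nested_sum (map (\<lambda>f n. norm (f n)) (rev (fs @ [f]))) N \<le> K"
    by auto
  then have "nested_sum (rev (fs @ [f])) \<longlonglongrightarrow> (\<Sum>\<^sub>\<infinity>l\<in>weak_chains (length (fs @ [f])).
       \<Prod>i<length (fs @ [f]). ((fs @ [f]) ! i) (l ! i))"
    by (rule nested_sum_tendsto_infsum)
  also have "(\<Sum>\<^sub>\<infinity>l\<in>weak_chains (length (fs @ [f])). \<Prod>i<length (fs @ [f]). ((fs @ [f]) ! i) (l ! i)) =
    (\<Sum>\<^sub>\<infinity>l\<in>weak_chains (Suc (length fs)). (\<Prod>i<length fs. (fs ! i) (l ! i)) * f (last l))"
    by (simp only: length_append list.size add_0_right add_Suc_right, intro infsum_cong)
      (auto simp: nth_append last_weak_chain)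
  finally show ?thesis by (simp del: nested_sum.simps)
qed

lemma prod_hurwitz_terms:
  assumes "length ms = length ks"
  shows "(\<Prod>i<length ks. (map2 (hurwitz_term \<mu>) ks ms ! i) (l ! i)) =
    \<mu> ^ length ks / (\<Prod>i<length ks. (of_nat (l ! i) * \<mu> + of_rat (ms ! i)) ^ (ks ! i))"
  using assms by (simp add: hurwitz_term_def prod_dividef)

lemma map2_hurwitz_terms_subset:
  assumes "\<forall>a\<in>set ks. a \<ge> 1" "\<forall>a\<in>set ms. a > 0"
  shows "set (map2 (hurwitz_term \<mu>) ks ms) \<subseteq> inner_terms \<mu>"
  using assms unfolding inner_terms_def by (fastforce dest: set_zip_leftD set_zip_rightD)

lemma prod_hurwitz_terms_snoc:
  assumes "length ms = length ks"
  shows "(\<Prod>i<length ks. (of_nat (l ! i) * \<mu> + of_rat ((ms @ [m]) ! i)) ^ ((ks @ [k]) ! i)) =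
    (\<Prod>i<length ks. (of_nat (l ! i) * \<mu> + of_rat (ms ! i)) ^ (ks ! i))"
  using assms by (intro prod.cong) (auto simp: nth_append)

lemma zeta_mu_limit:
  assumes "admissible (ks @ [k]) (ms @ [m])"
  shows "nested_sum (hurwitz_term \<mu> k m # rev (map2 (hurwitz_term \<mu>) ks ms))
    \<longlonglongrightarrow> zeta_mu \<mu> (ks @ [k]) (ms @ [m])"
proof -
  have len: "length ms = length ks" using assms by (simp add: admissible_def)
  then have len_map: "length (map2 (hurwitz_term \<mu>) ks ms) = length ks" by simp
  have f: "hurwitz_term \<mu> k m \<in> outer_terms \<mu>"
    using assms by (intro hurwitz_term_outer) (auto simp: admissible_def)
  have fs: "set (map2 (hurwitz_term \<mu>) ks ms) \<subseteq> inner_terms \<mu>"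
    using assms by (intro map2_hurwitz_terms_subset) (auto simp: admissible_def)
  \<comment> \<open>The power of \<open>\<mu>\<close> is dealt out, one factor to each term.\<close>
  have summand: "\<mu> ^ Suc (length ks) / (\<Prod>i<Suc (length ks).
        (of_nat (l ! i) * \<mu> + of_rat ((ms @ [m]) ! i)) ^ ((ks @ [k]) ! i)) =
      (\<Prod>i<length ks. (map2 (hurwitz_term \<mu>) ks ms ! i) (l ! i)) * hurwitz_term \<mu> k m (last l)"
    if "l \<in> weak_chains (Suc (length ks))" for l
    unfolding prod_hurwitz_terms[OF len] prod.lessThan_Suc prod_hurwitz_terms_snoc[OF len]
      last_weak_chain[OF that]
    by (simp add: hurwitz_term_def nth_append len)
  have "zeta_mu \<mu> (ks @ [k]) (ms @ [m]) = (\<Sum>\<^sub>\<infinity>l\<in>weak_chains (Suc (length ks)).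
      (\<Prod>i<length ks. (map2 (hurwitz_term \<mu>) ks ms ! i) (l ! i)) * hurwitz_term \<mu> k m (last l))"
    unfolding zeta_mu_def length_append_singleton by (intro infsum_cong summand)
  with outer_sum_tendsto_infsum[OF f fs] show ?thesis unfolding len_map by argo
qed

lemma D_mu_limit:
  assumes "special_triple (ks @ [1]) (ms @ [m]) (ms @ [m'])"
  shows "nested_sum ((\<lambda>n. hurwitz_term \<mu> 1 m n - hurwitz_term \<mu> 1 m' n) #
      rev (map2 (hurwitz_term \<mu>) ks ms)) \<longlonglongrightarrow> D_mu \<mu> (ks @ [1]) (ms @ [m]) (ms @ [m'])"
proof -
  have len: "length ms = length ks" and m: "m > 0" "m' > 0"
    using assms by (auto simp: special_triple_def)
  then have len_map: "length (map2 (hurwitz_term \<mu>) ks ms) = length ks" by simp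
  have f: "(\<lambda>n. hurwitz_term \<mu> 1 m n - hurwitz_term \<mu> 1 m' n) \<in> outer_terms \<mu>"
    using assms by (intro hurwitz_term_diff_outer) (auto simp: special_triple_def)
  have fs: "set (map2 (hurwitz_term \<mu>) ks ms) \<subseteq> inner_terms \<mu>"
    using assms by (intro map2_hurwitz_terms_subset) (auto simp: special_triple_def)
  have summand: "of_rat (m' - m) * (\<mu> ^ Suc (length ks) / ((\<Prod>i<length ks.
        (of_nat (l ! i) * \<mu> + of_rat ((ms @ [m]) ! i)) ^ ((ks @ [1]) ! i)) *
        (of_nat (last l) * \<mu> + of_rat m) * (of_nat (last l) * \<mu> + of_rat m'))) =
      (\<Prod>i<length ks. (map2 (hurwitz_term \<mu>) ks ms ! i) (l ! i)) *
        (hurwitz_term \<mu> 1 m (last l) - hurwitz_term \<mu> 1 m' (last l))" for l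
    unfolding prod_hurwitz_terms[OF len] prod_hurwitz_terms_snoc[OF len] hurwitz_term_diff[OF m]
    by (simp add: mult_ac)
  have "D_mu \<mu> (ks @ [1]) (ms @ [m]) (ms @ [m']) = (\<Sum>\<^sub>\<infinity>l\<in>weak_chains (Suc (length ks)).
      (\<Prod>i<length ks. (map2 (hurwitz_term \<mu>) ks ms ! i) (l ! i)) *
        (hurwitz_term \<mu> 1 m (last l) - hurwitz_term \<mu> 1 m' (last l)))"
    \<comment> \<open>The rational prefactor moves into the series first, where it turns the last
      two denominators into a difference of terms.\<close>
    unfolding D_mu_def infsum_cmult_right'[symmetric] length_append_singleton last_snoc diff_Suc_1
    by (intro infsum_cong summand)
  with outer_sum_tendsto_infsum[OF f fs] show ?thesis unfolding len_map by argo
qed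

text \<open>With the converse \<open>outer_sums_limit\<close>, this matches the generators with the
  limits of outer sums.\<close>

lemma Z_gens_limit:
  assumes "z \<in> Z_gens \<mu>"
  shows "\<exists>c\<in>outer_sums \<mu>. c \<longlonglongrightarrow> z"
  using assms unfolding Z_gens_def
proof (elim UnE CollectE exE conjE)
  assume "z \<in> {1}"
  then show ?thesis by (intro bexI[of _ "\<lambda>_. 1"]) (auto simp: outer_sums_def)
next
  fix k m assume z: "z = zeta_mu \<mu> k m" and adm: "admissible k m"
  then have "k \<noteq> []" "m \<noteq> []" by (auto simp: admissible_def)
  then obtain ks k' ms m' where km: "k = ks @ [k']" "m = ms @ [m']"
    by (metis append_butlast_last_id)
  have "hurwitz_term \<mu> k' m' \<in> outer_terms \<mu>"
    using adm by (intro hurwitz_term_outer) (auto simp: km admissible_def)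
  moreover have "set (rev (map2 (hurwitz_term \<mu>) ks ms)) \<subseteq> inner_terms \<mu>"
    using adm map2_hurwitz_terms_subset[of ks ms] by (auto simp: km admissible_def)
  ultimately have "nested_sum (hurwitz_term \<mu> k' m' # rev (map2 (hurwitz_term \<mu>) ks ms)) \<in> outer_sums \<mu>"
    unfolding outer_sums_def by blast
  then show ?thesis using zeta_mu_limit adm z km by blast
next
  fix k m m' assume z: "z = D_mu \<mu> k m m'" and sp: "special_triple k m m'"
  then have ne: "k \<noteq> []" "m \<noteq> []" "m' \<noteq> []" by (auto simp: special_triple_def)
  define ks ms a b where "ks = butlast k" "ms = butlast m" "a = last m" "b = last m'"
  have km: "k = ks @ [1]" "m = ms @ [a]" "m' = ms @ [b]"
    using sp ne by (auto simp: special_triple_def ks_ms_a_b_def) (metis append_butlast_last_id)+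
  have "(\<lambda>n. hurwitz_term \<mu> 1 a n - hurwitz_term \<mu> 1 b n) \<in> outer_terms \<mu>"
    using sp by (intro hurwitz_term_diff_outer) (auto simp: km special_triple_def)
  moreover have "set (rev (map2 (hurwitz_term \<mu>) ks ms)) \<subseteq> inner_terms \<mu>"
    using sp map2_hurwitz_terms_subset[of ks ms] by (auto simp: km special_triple_def)
  ultimately have "nested_sum ((\<lambda>n. hurwitz_term \<mu> 1 a n - hurwitz_term \<mu> 1 b n) #
      rev (map2 (hurwitz_term \<mu>) ks ms)) \<in> outer_sums \<mu>"
    unfolding outer_sums_def by blast
  then show ?thesis using D_mu_limit sp z km by blast
qed

lemma inner_terms_eq_map2:
  assumes "set fs \<subseteq> inner_terms \<mu>"
  shows "\<exists>ks ms. length ms = length ks \<and> (\<forall>a\<in>set ks. a \<ge> 1) \<and> (\<forall>a\<in>set ms. a > 0) \<and>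
    fs = rev (map2 (hurwitz_term \<mu>) ks ms)"
  using assms
proof (induction fs)
  case (Cons f fs)
  then obtain ks ms where fs: "length ms = length ks" "\<forall>a\<in>set ks. a \<ge> 1" "\<forall>a\<in>set ms. a > 0"
    "fs = rev (map2 (hurwitz_term \<mu>) ks ms)" by auto
  obtain k m where "f = hurwitz_term \<mu> k m" "k \<ge> 1" "m > 0"
    using Cons.prems by (auto simp: inner_terms_def)
  with fs show ?case
    \<comment> \<open>The head of \<open>fs\<close> belongs to the largest index, so its parameters
      go to the end.\<close>
    by (intro exI[of _ "ks @ [k]"] exI[of _ "ms @ [m]"]) auto
qed (intro exI[of _ "[]"], simp)

lemma outer_sums_limit:
  assumes "c \<in> outer_sums \<mu>"
  shows "\<exists>z\<in>Z_gens \<mu>. c \<longlonglongrightarrow> z"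
proof (cases "c = (\<lambda>_. 1)")
  case True
  then show ?thesis by (intro bexI[of _ 1]) (auto simp: Z_gens_def)
next
  case False
  then obtain f fs where c: "c = nested_sum (f # fs)" and f: "f \<in> outer_terms \<mu>"
    and fs: "set fs \<subseteq> inner_terms \<mu>"
    using assms by (auto simp: outer_sums_def simp del: nested_sum.simps)
  obtain ks ms where w: "length ms = length ks" "\<forall>a\<in>set ks. a \<ge> 1" "\<forall>a\<in>set ms. a > 0"
    "fs = rev (map2 (hurwitz_term \<mu>) ks ms)" using inner_terms_eq_map2[OF fs] by blast
  show ?thesis using f unfolding outer_terms_def
  proof (elim UnE CollectE exE conjE)
    fix k m assume km: "f = hurwitz_term \<mu> k m" "k \<ge> 2" "m > 0"
    then have "admissible (ks @ [k]) (ms @ [m])" using w by (auto simp: admissible_def)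
    with zeta_mu_limit[OF this] show ?thesis unfolding c km(1) w(4) Z_gens_def by blast
  next
    fix m m' :: rat
    assume f: "f = (\<lambda>n. hurwitz_term \<mu> 1 m n - hurwitz_term \<mu> 1 m' n)"
      and m: "m > 0" "m' > 0" "m \<noteq> m'"
    have "special_triple (ks @ [1]) (ms @ [m]) (ms @ [m'])"
      using w m by (auto simp: special_triple_def)
    with D_mu_limit[OF this] show ?thesis unfolding c f w(4) Z_gens_def by blast
  qed
qed

section \<open>\<open>Z_mu\<close> as the set of limits of the span of outer sums\<close>

lemma Z_mu_is_limit:
  assumes "z \<in> Z_mu \<mu>"
  shows "\<exists>c\<in>fun_span (rat_adjoin \<mu>) (outer_sums \<mu>). c \<longlonglongrightarrow> z"
  using assms unfolding Z_mu_eq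
proof (induction rule: span_over_induct)
  case zero
  \<comment> \<open>The zero sequence enters \<open>fun_span\<close> as 0 times the constant
    generator 1.\<close>
  have "(\<lambda>_. 0 * 1) \<in> fun_span (rat_adjoin \<mu>) (outer_sums \<mu>)"
    by (intro fun_span_scale zero_in_rat_adjoin fun_span_base) (simp add: outer_sums_def)
  then show ?case by (intro bexI[of _ "\<lambda>_. 0 * 1"]) auto
next
  case (base a g y)
  obtain b where "b \<in> fun_span (rat_adjoin \<mu>) (outer_sums \<mu>)" "b \<longlonglongrightarrow> y" using base by blast
  moreover obtain c where "c \<in> outer_sums \<mu>" "c \<longlonglongrightarrow> g" using Z_gens_limit base by blast
  ultimately show ?case using base(1)
    by (intro bexI[of _ "\<lambda>n. a * c n + b n"])
      (auto intro!: tendsto_intros fun_span_add fun_span_scale intro: fun_span_base)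
qed

lemma limit_in_Z_mu:
  assumes "c \<in> fun_span (rat_adjoin \<mu>) (outer_sums \<mu>)"
  shows "\<exists>z\<in>Z_mu \<mu>. c \<longlonglongrightarrow> z"
  using assms
proof induction
  case (fun_span_base c)
  then show ?case using outer_sums_limit Z_gens_subset by blast
next
  case (fun_span_add b c)
  then show ?case using Z_mu_add tendsto_add by blast
next
  case (fun_span_scale a c)
  then show ?case using Z_mu_scale tendsto_mult_left by blast
qed

text \<open>The product of approximating sequences stays in the span, so it has a limit in
  \<open>Z_mu\<close>; uniqueness of limits makes that limit \<open>x * y\<close>.\<close>

lemma Z_mu_mult:
  assumes "x \<in> Z_mu \<mu>" "y \<in> Z_mu \<mu>"
  shows "x * y \<in> Z_mu \<mu>"
proof -
  obtain b c where b: "b \<in> fun_span (rat_adjoin \<mu>) (outer_sums \<mu>)" "b \<longlonglongrightarrow> x"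
    and c: "c \<in> fun_span (rat_adjoin \<mu>) (outer_sums \<mu>)" "c \<longlonglongrightarrow> y"
    using assms Z_mu_is_limit by blast
  obtain z where "z \<in> Z_mu \<mu>" "(\<lambda>n. b n * c n) \<longlonglongrightarrow> z"
    using limit_in_Z_mu[OF outer_sums_span_mult[OF b(1) c(1)]] by blast
  moreover have "(\<lambda>n. b n * c n) \<longlonglongrightarrow> x * y" using b(2) c(2) by (rule tendsto_mult)
  ultimately show ?thesis using LIMSEQ_unique by blast
qed

end

theorem theorem2p5:
  fixes \<mu> :: complex
  assumes "Re \<mu> > 0"
  shows "subalgebra_over (rat_adjoin \<mu>) (Z_mu \<mu>) \<and>
    (\<forall>k1 m1 k2 m2. admissible k1 m1 \<longrightarrow> admissible k2 m2 \<longrightarrow>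
       zeta_mu \<mu> k1 m1 * zeta_mu \<mu> k2 m2 \<in> Z_mu \<mu>) \<and>
    (\<forall>k1 m1 k3 m3 m3'. admissible k1 m1 \<longrightarrow> special_triple k3 m3 m3' \<longrightarrow>
       zeta_mu \<mu> k1 m1 * D_mu \<mu> k3 m3 m3' \<in> Z_mu \<mu>) \<and>
    (\<forall>k3 m3 m3' k4 m4 m4'. special_triple k3 m3 m3' \<longrightarrow> special_triple k4 m4 m4' \<longrightarrow>
       D_mu \<mu> k3 m3 m3' * D_mu \<mu> k4 m4 m4' \<in> Z_mu \<mu>)"
proof -
  have "1 \<in> Z_mu \<mu>" "\<And>k m. admissible k m \<Longrightarrow> zeta_mu \<mu> k m \<in> Z_mu \<mu>"
    "\<And>k m m'. special_triple k m m' \<Longrightarrow> D_mu \<mu> k m m' \<in> Z_mu \<mu>"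
    using Z_gens_subset[of \<mu>] unfolding Z_gens_def by blast+
  then show ?thesis
    unfolding subalgebra_over_def
    by (intro conjI ballI allI impI Z_mu_mult[OF assms] Z_mu_add Z_mu_scale)
qed

end
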